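(* Let $X$ be a set, let $B\subseteq 2^X$ be a compact family with VC dimension $v$ and Helly number $h$, and let $B^\cap$ denote the family of all sets obtained by taking arbitrary intersections of members of $B$. Then for every $\varepsilon>0$, $B^\cap$ has weak $\varepsilon$-nets of size at most $\beta<(120h^2/\varepsilon)^{4hv\ln(1/\varepsilon)}$; i.e., for every probability distribution $\mu$ on $X$ there is a set $S\subseteq X$ of size less than $(120h^2/\varepsilon)^{4hv\ln(1/\varepsilon)}$ meeting every $c\in B^\cap$ with $\mu(c)\ge\varepsilon$.
   Context: A family $B$ is compact if for every $B'\subseteq B$ with $\bigcap B'=\emptyset$ there is a finite $B''\subseteq B'$ with $\bigcap B''=\emptyset$. The Helly number of $B$ is the minimum $h$ such that every finite $B'\subseteq B$ with $\bigcap B'=\emptyset$ contains at most $h$ sets whose intersection is already empty. The VC dimension of $B\subseteq 2^X$ is the supremum of $v$ such that some $Y\subseteq X$ with $|Y|=v$ has, for every $Z\subseteq Y$, some $b\in B$ with $b\cap Y=Z$. All sets considered are assumed measurable with respect to $\mu$. A weak $\varepsilon$-net for a family $C$ over $\mu$ is a set $S\subseteq X$ with $S\cap c\ne\emptyset$ for all $c\in C$ with $\mu(c)\ge\varepsilon$.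
   Formalization: The formal statement assumes ε<1, v≥1 and h≥1; for ε=1, v=0 or h=0 the stated bound degenerates to 1 or 0^0 and would force an empty net, which fails in general (e.g. ε=1 with a member of measure 1), while ε>1 is vacuous. *)

theory Defs
  imports "HOL-Probability.Probability"
begin

definition compact_family :: "'a set set \<Rightarrow> bool" where
  "compact_family B \<longleftrightarrow>
     (\<forall>B'\<subseteq>B. \<Inter>B' = {} \<longrightarrow> (\<exists>B''\<subseteq>B'. finite B'' \<and> \<Inter>B'' = {}))"

definition helly_bound :: "'a set set \<Rightarrow> nat \<Rightarrow> bool" where
  "helly_bound B h \<longleftrightarrow>
     (\<forall>B'\<subseteq>B. finite B' \<and> \<Inter>B' = {} \<longrightarrow>
        (\<exists>B''\<subseteq>B'. card B'' \<le> h \<and> \<Inter>B'' = {}))"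

definition helly_number :: "'a set set \<Rightarrow> nat \<Rightarrow> bool" where
  "helly_number B h \<longleftrightarrow> helly_bound B h \<and> (\<forall>h'<h. \<not> helly_bound B h')"

definition shatters :: "'a set set \<Rightarrow> 'a set \<Rightarrow> bool" where
  "shatters B Y \<longleftrightarrow> (\<forall>Z\<subseteq>Y. \<exists>b\<in>B. b \<inter> Y = Z)"

definition vc_dim :: "'a set \<Rightarrow> 'a set set \<Rightarrow> nat \<Rightarrow> bool" where
  "vc_dim X B v \<longleftrightarrow>
     (\<exists>Y\<subseteq>X. finite Y \<and> card Y = v \<and> shatters B Y) \<and>
     (\<forall>Y\<subseteq>X. finite Y \<and> shatters B Y \<longrightarrow> card Y \<le> v)"

definition intersection_closure :: "'a set set \<Rightarrow> 'a set set" where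
  "intersection_closure B = {\<Inter>F | F. F \<subseteq> B \<and> F \<noteq> {}}"

definition weak_eps_net :: "'a measure \<Rightarrow> 'a set set \<Rightarrow> real \<Rightarrow> 'a set \<Rightarrow> bool" where
  "weak_eps_net M C \<epsilon> S \<longleftrightarrow> (\<forall>c\<in>C. measure M c \<ge> \<epsilon> \<longrightarrow> S \<inter> c \<noteq> {})"

end

theory Submission
  imports Defs
begin

text \<open>
  By compactness and the Helly property there is one point \<open>p\<close> lying in all \<open>b \<in> B\<close> of measure
  greater than \<open>1 - 1/h\<close>. If \<open>p\<close> misses an intersection \<open>c\<close> with \<open>\<mu>(c) \<ge> \<epsilon>\<close>, then \<open>c \<subseteq> b\<close> for some
  \<open>b \<in> B\<close> with \<open>\<mu>(b) \<le> 1 - 1/h\<close>. Replace \<open>b\<close> by a nearby member \<open>g\<close> of a maximal family whose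
  members have pairwise distance greater than \<open>\<delta> = \<epsilon>/(20h)\<close> in \<open>L\<^sup>1(\<mu>)\<close>; such a family has at most
  \<open>(12/\<delta>)\<^sup>2\<^sup>v\<close> members. Conditioning \<open>\<mu>\<close> on \<open>g\<close> raises the measure of \<open>c\<close> to at least
  \<open>\<epsilon> \<cdot> exp(3/(4h))\<close>, so about \<open>(4/3) h ln(1/\<epsilon>)\<close> rounds of conditioning suffice.
\<close>

section \<open>Shattered subsets and the Sauer--Shelah bound\<close>

text \<open>Pajor's form of the Sauer--Shelah lemma, by removing one point \<open>x\<close>. The
  family splits into its traces \<open>A\<close> on \<open>Y\<close> and the traces \<open>D\<close>
  that arise twice, with and without \<open>x\<close>. A set shattered by \<open>A\<close> is
  shattered by \<open>F\<close>; a set shattered by \<open>D\<close> remains shattered by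
  \<open>F\<close> after \<open>x\<close> is added. These two kinds of sets differ in whether they
  contain \<open>x\<close>, so nothing is counted twice.\<close>

lemma card_le_card_shattered:
  assumes "finite Y" "F \<subseteq> Pow Y"
  shows "card F \<le> card {Z. Z \<subseteq> Y \<and> shatters F Z}"
  using assms
proof (induction Y arbitrary: F rule: finite_induct)
  case empty
  show ?case
  proof (cases "F = {}")
    case False
    with empty have "F = {{}}" by auto
    then have "{Z. Z \<subseteq> {} \<and> shatters F Z} = {{}}" by (auto simp: shatters_def)
    then show ?thesis using \<open>F = {{}}\<close> by simp
  qed simp
next
  case (insert x Y)
  define A where "A = (\<lambda>b. b - {x}) ` F"
  define D where "D = {b. b \<subseteq> Y \<and> b \<in> F \<and> insert x b \<in> F}"
  have finF: "finite F" using insert by (meson finite_Pow_iff finite_insert finite_subset)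
  have AY: "A \<subseteq> Pow Y" and DY: "D \<subseteq> Pow Y" using insert by (auto simp: A_def D_def)
  have finA: "finite A" and finD: "finite D"
    using AY DY insert(1) by (meson finite_Pow_iff finite_subset)+
  have xD: "x \<notin> d" if "d \<in> D" for d using that insert(2) by (auto simp: D_def)
  have cF: "card F = card A + card D"
  proof -
    \<comment> \<open>\<open>?E\<close> keeps exactly one member of \<open>F\<close> for each trace
      on \<open>Y\<close>, preferring the one without \<open>x\<close>. The rest, \<open>?E'\<close>
      below, is a copy of \<open>D\<close>.\<close>
    let ?E = "{b\<in>F. \<not> (x \<in> b \<and> b - {x} \<in> F)}"
    have "inj_on (\<lambda>b. b - {x}) ?E"
    proof (rule inj_onI)
      have E: "x \<in> b'" if "b \<in> ?E" "b' \<in> ?E" "b - {x} = b' - {x}" "x \<in> b" for b b'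
      proof (rule ccontr)
        assume "x \<notin> b'"
        then have "b - {x} = b'" using that(3) by simp
        then show False using that by simp
      qed
      fix b b' assume "b \<in> ?E" "b' \<in> ?E" "b - {x} = b' - {x}"
      then show "b = b'" using E[of b b'] E[of b' b] by blast
    qed
    moreover have "(\<lambda>b. b - {x}) ` ?E = A"
    proof
      show "A \<subseteq> (\<lambda>b. b - {x}) ` ?E"
      proof
        fix a assume "a \<in> A"
        then obtain b where b: "b \<in> F" "a = b - {x}" by (auto simp: A_def)
        show "a \<in> (\<lambda>b. b - {x}) ` ?E"
        proof (cases "x \<in> b \<and> b - {x} \<in> F")
          case True
          then show ?thesis using b by (intro image_eqI[of _ _ "b - {x}"]) auto
        qed (use b in auto)
      qed
    qed (auto simp: A_def)
    ultimately have cE: "card ?E = card A" using card_image[of "\<lambda>b. b - {x}" ?E] by simp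
    let ?E' = "{b\<in>F. x \<in> b \<and> b - {x} \<in> F}"
    have "?E' = insert x ` D"
    proof
      show "?E' \<subseteq> insert x ` D"
      proof
        fix b assume "b \<in> ?E'"
        then show "b \<in> insert x ` D" using insert(4)
          by (intro image_eqI[of _ _ "b - {x}"]) (auto simp: D_def insert_absorb)
      qed
      show "insert x ` D \<subseteq> ?E'"
      proof
        fix b assume "b \<in> insert x ` D"
        then obtain d where d: "b = insert x d" "d \<in> D" by blast
        then have "b - {x} = d" using insert(2) by (auto simp: D_def)
        then show "b \<in> ?E'" using d by (auto simp: D_def)
      qed
    qed
    moreover have "inj_on (insert x) D"
      by (rule inj_onI) (metis insert_ident xD)
    ultimately have cE': "card ?E' = card D" by (simp add: card_image)
    have "card F = card (?E \<union> ?E')" by (rule arg_cong[of _ _ card]) auto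
    also have "\<dots> = card ?E + card ?E'" using finF by (intro card_Un_disjoint) auto
    finally show ?thesis using cE cE' by simp
  qed
  let ?SA = "{Z. Z \<subseteq> Y \<and> shatters A Z}" and ?SD = "{Z. Z \<subseteq> Y \<and> shatters D Z}"
  have fin: "finite {Z. Z \<subseteq> insert x Y \<and> shatters F Z}" "finite ?SA" "finite ?SD"
    using insert(1) by (auto intro: finite_subset[of _ "Pow (insert x Y)"])
  have inj: "inj_on (insert x) ?SD"
    by (rule inj_onI) (use insert(2) in \<open>metis (no_types, lifting) insert_ident mem_Collect_eq subsetD\<close>)
  have "card F \<le> card ?SA + card ?SD"
    using cF insert.IH[OF AY] insert.IH[OF DY] by linarith
  also have "\<dots> = card (?SA \<union> insert x ` ?SD)"
    using fin insert(2) by (subst card_Un_disjoint) (auto simp: card_image[OF inj])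
  also have "\<dots> \<le> card {Z. Z \<subseteq> insert x Y \<and> shatters F Z}"
  proof (rule card_mono[OF fin(1)], intro Un_least subsetI)
    fix Z assume Z: "Z \<in> ?SA"
    then have xZ: "x \<notin> Z" using insert(2) by auto
    have "\<exists>b\<in>F. b \<inter> Z = W" if W: "W \<subseteq> Z" for W
    proof -
      obtain a where a: "a \<in> A" "a \<inter> Z = W" using Z W unfolding shatters_def by blast
      then obtain b where "b \<in> F" "a = b - {x}" by (auto simp: A_def)
      then show ?thesis using a xZ by blast
    qed
    then show "Z \<in> {Z. Z \<subseteq> insert x Y \<and> shatters F Z}" using Z unfolding shatters_def by blast
  next
    fix Z assume "Z \<in> insert x ` ?SD"
    then obtain Z' where Z': "Z = insert x Z'" "Z' \<subseteq> Y" "shatters D Z'" by auto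
    have xZ: "x \<notin> Z'" using insert(2) Z' by auto
    have "\<exists>b\<in>F. b \<inter> Z = W" if W: "W \<subseteq> Z" for W
    proof -
      obtain d where d: "d \<in> D" "d \<inter> Z' = W - {x}"
        using Z' W unfolding shatters_def by (metis Diff_subset_conv insert_is_Un)
      have dF: "d \<in> F" "insert x d \<in> F" using d by (auto simp: D_def)
      show ?thesis
      proof (cases "x \<in> W")
        case True
        then have "insert x d \<inter> Z = W" using d(2) W Z'(1) by blast
        then show ?thesis using dF by blast
      next
        case False
        then have "d \<inter> Z = W" using d(2) W Z'(1) xD[OF d(1)] by blast
        then show ?thesis using dF by blast
      qed
    qed
    then show "Z \<in> {Z. Z \<subseteq> insert x Y \<and> shatters F Z}" using Z' unfolding shatters_def by blast
  qed
  finally show ?case .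
qed

text \<open>Since \<open>v / k\<close> is at most 1, weighting the sum by its power \<open>v\<close>
  only lowers each term below the corresponding term of the binomial expansion of
  \<open>(1 + v / k) ^ k\<close>, which is at most \<open>exp v\<close>.\<close>

lemma sum_binomial_le:
  fixes k v :: nat
  assumes "1 \<le> v" "v \<le> k"
  shows "real (\<Sum>i\<le>v. k choose i) \<le> (exp 1 * real k / real v) ^ v"
proof -
  let ?r = "real v / real k"
  have r: "0 < ?r" "?r \<le> 1" using assms by auto
  have "real (\<Sum>i\<le>v. k choose i) * ?r ^ v = (\<Sum>i\<le>v. real (k choose i) * ?r ^ v)"
    by (simp add: sum_distrib_right)
  also have "\<dots> \<le> (\<Sum>i\<le>v. real (k choose i) * ?r ^ i)"
    using r by (intro sum_mono mult_left_mono power_decreasing) auto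
  also have "\<dots> \<le> (\<Sum>i\<le>k. real (k choose i) * ?r ^ i)"
    using assms r by (intro sum_mono2) auto
  also have "\<dots> = (?r + 1) ^ k" by (simp add: binomial_ring)
  also have "\<dots> \<le> exp ?r ^ k"
    using r by (intro power_mono) (auto simp: add.commute exp_ge_add_one_self)
  also have "\<dots> = exp (real v)" using assms by (simp flip: exp_of_nat_mult)
  also have "\<dots> = exp 1 ^ v" by (simp flip: exp_of_nat_mult)
  finally have "real (\<Sum>i\<le>v. k choose i) \<le> exp 1 ^ v / ?r ^ v"
    using r by (simp add: pos_le_divide_eq del: of_nat_sum)
  also have "\<dots> = (exp 1 * real k / real v) ^ v"
    by (simp add: power_divide power_mult_distrib)
  finally show ?thesis .
qed

lemma card_subsets_le:
  assumes "finite Y" "card Y \<le> k"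
  shows "card {Z. Z \<subseteq> Y \<and> card Z \<le> v} \<le> (\<Sum>i\<le>v. k choose i)"
proof -
  have "card {Z. Z \<subseteq> Y \<and> card Z \<le> v} = card (\<Union>i\<le>v. {Z. Z \<subseteq> Y \<and> card Z = i})"
    by (rule arg_cong[of _ _ card]) auto
  also have "\<dots> \<le> (\<Sum>i\<le>v. card {Z. Z \<subseteq> Y \<and> card Z = i})"
    by (rule card_UN_le) simp
  also have "\<dots> = (\<Sum>i\<le>v. card Y choose i)" using assms by (simp add: n_subsets)
  also have "\<dots> \<le> (\<Sum>i\<le>v. k choose i)" using assms by (intro sum_mono binomial_right_mono) auto
  finally show ?thesis .
qed

section \<open>Packing and covering by symmetric differences\<close>

context prob_space
begin

text \<open>Averaging: the expected number of sets \<open>D i\<close> containing a point is the sum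
  of their probabilities, so some point reaches the average.\<close>

lemma popular_point:
  assumes "finite I" "I \<noteq> {}" "\<And>i. i \<in> I \<Longrightarrow> D i \<in> sets M" "\<And>i. i \<in> I \<Longrightarrow> \<delta> < prob (D i)"
  shows "\<exists>x\<in>space M. \<delta> * real (card I) \<le> real (card {i\<in>I. x \<in> D i})"
proof (rule ccontr)
  assume neg: "\<not> ?thesis"
  let ?f = "\<lambda>x. \<Sum>i\<in>I. indicat_real (D i) x"
  have int: "integrable M (indicat_real (D i))" if "i \<in> I" for i
    using assms(3)[OF that] by (simp add: emeasure_eq_measure)
  have f: "?f x = real (card {i\<in>I. x \<in> D i})" for x
    using assms(1) by (simp add: indicator_def sum.If_cases Int_def)
  have "\<delta> * real (card I) = (\<Sum>i\<in>I. \<delta>)" by simp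
  also have "\<dots> < (\<Sum>i\<in>I. prob (D i))" using assms by (intro sum_strict_mono) auto
  also have "\<dots> = expectation ?f"
    using assms(3) by (subst Bochner_Integration.integral_sum) (auto intro: int)
  also have "\<dots> \<le> expectation (\<lambda>_. \<delta> * real (card I))"
    using assms(3) neg by (intro integral_mono Bochner_Integration.integrable_sum)
       (auto simp: f intro: int)
  finally show False by (simp add: prob_space)
qed

text \<open>A greedy choice takes the place of random sampling: each new point is popular among the
  sets not yet hit, so it leaves at most a fraction \<open>1 - \<delta>\<close> of them.\<close>

lemma hitting_points:
  assumes "finite I" "\<And>i. i \<in> I \<Longrightarrow> D i \<in> sets M" "\<And>i. i \<in> I \<Longrightarrow> \<delta> < prob (D i)"
    and "\<delta> \<le> 1"
  shows "\<exists>Y\<subseteq>space M. finite Y \<and> card Y \<le> k \<and>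
           real (card {i\<in>I. D i \<inter> Y = {}}) \<le> real (card I) * (1 - \<delta>) ^ k"
proof (induction k)
  case 0
  show ?case by (intro exI[of _ "{}"]) auto
next
  case (Suc k)
  then obtain Y where Y: "Y \<subseteq> space M" "finite Y" "card Y \<le> k"
    "real (card {i\<in>I. D i \<inter> Y = {}}) \<le> real (card I) * (1 - \<delta>) ^ k" by blast
  let ?J = "{i\<in>I. D i \<inter> Y = {}}"
  show ?case
  proof (cases "?J = {}")
    case True
    then show ?thesis using Y assms(4)
      by (intro exI[of _ Y]) (auto simp: True)
  next
    case False
    obtain x where x: "x \<in> space M" "\<delta> * real (card ?J) \<le> real (card {i\<in>?J. x \<in> D i})"
      using popular_point[of ?J D \<delta>] assms False by auto
    have "card ?J = card {i\<in>?J. x \<in> D i} + card {i\<in>I. D i \<inter> insert x Y = {}}"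
      using assms(1) by (subst card_Un_disjoint[symmetric]) (auto intro!: arg_cong[of _ _ card])
    then have "real (card {i\<in>I. D i \<inter> insert x Y = {}}) \<le> (1 - \<delta>) * real (card ?J)"
      using x by (simp add: algebra_simps)
    also have "\<dots> \<le> (1 - \<delta>) * (real (card I) * (1 - \<delta>) ^ k)"
      using Y assms(4) by (intro mult_left_mono) auto
    finally show ?thesis using x Y
      by (intro exI[of _ "insert x Y"]) (auto simp: card_insert_if algebra_simps)
  qed
qed

text \<open>A packing bound for bounded VC dimension. A number of points logarithmic in
  \<open>card G\<close> hits all pairwise symmetric differences, while the number of traces on these
  points is polynomial in their number. Comparing the two bounds \<open>card G\<close>.\<close>

lemma card_separated_le:
  assumes B: "B \<subseteq> sets M" and vc: "vc_dim (space M) B v" and v: "v \<ge> 1"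
    and \<delta>: "0 < \<delta>" "\<delta> \<le> 1" and G: "finite G" "G \<subseteq> B"
    and sep: "\<And>b b'. b \<in> G \<Longrightarrow> b' \<in> G \<Longrightarrow> b \<noteq> b' \<Longrightarrow> \<delta> < prob (sym_diff b b')"
  shows "real (card G) \<le> (12 / \<delta>) ^ (2 * v)"
proof (cases "G = {}")
  case True
  then show ?thesis using \<delta> by simp
next
  case False
  define m where "m = card G"
  have m: "1 \<le> m" using False G by (simp add: m_def Suc_le_eq card_gt_0_iff)
  define l where "l = ln (real m) / real v"
  define u where "u = exp l"
  have l0: "0 \<le> l" using m by (simp add: l_def)
  have um: "u ^ v = real m" using m v by (simp add: u_def l_def flip: exp_of_nat_mult)
  \<comment> \<open>The added 1 makes \<open>k * \<delta>\<close> strictly exceed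
    \<open>2 * ln m\<close>, so that fewer than one of the at most \<open>m ^ 2\<close> ordered
    pairs stays unhit, hence none. Taking \<open>k\<close> as a positive multiple of
    \<open>v\<close> gives \<open>v \<le> k\<close> and \<open>k / v = q\<close> for the binomial
    estimate.\<close>
  define q where "q = nat \<lfloor>2 * l / \<delta>\<rfloor> + 1"
  have "0 \<le> 2 * l / \<delta>" using l0 \<delta> by simp
  then have q: "2 * l / \<delta> < real q" "real q \<le> 2 * l / \<delta> + 1"
    unfolding q_def by linarith+
  define k where "k = v * q"
  have vk: "v \<le> k" by (simp add: k_def q_def)
  define I where "I = {(b, b'). b \<in> G \<and> b' \<in> G \<and> b \<noteq> b'}"
  have IG: "I \<subseteq> G \<times> G" by (auto simp: I_def)
  then have finI: "finite I" using G by (meson finite_SigmaI finite_subset)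
  have "card I \<le> card (G \<times> G)" using G IG by (intro card_mono) auto
  then have cI: "real (card I) \<le> real m ^ 2"
    by (simp add: m_def card_cartesian_product power2_eq_square flip: of_nat_mult)
  have GM: "b \<in> sets M" if "b \<in> G" for b using that G B by auto
  obtain Y where Y: "Y \<subseteq> space M" "finite Y" "card Y \<le> k"
    "real (card {i\<in>I. (\<lambda>(b, b'). sym_diff b b') i \<inter> Y = {}}) \<le> real (card I) * (1 - \<delta>) ^ k"
    using hitting_points[OF finI, of "\<lambda>(b, b'). sym_diff b b'" \<delta> k] sep \<delta> GM by (auto simp: I_def)
  have "(1 - \<delta>) ^ k \<le> exp (- \<delta>) ^ k"
    using \<delta> exp_ge_add_one_self[of "- \<delta>"] by (intro power_mono) auto
  also have "\<dots> = exp (- (real k * \<delta>))" by (simp flip: exp_of_nat_mult)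
  also have "\<dots> < exp (- (2 * ln (real m)))"
  proof -
    have "real v * (2 * l) < real v * (real q * \<delta>)"
      using q \<delta> v by (simp add: field_simps)
    then show ?thesis using v by (simp add: k_def l_def algebra_simps)
  qed
  also have "\<dots> = 1 / real m ^ 2"
    using m by (simp add: exp_minus exp_double field_simps)
  finally have "real m ^ 2 * (1 - \<delta>) ^ k < 1" using m by (simp add: field_simps)
  moreover have "real (card I) * (1 - \<delta>) ^ k \<le> real m ^ 2 * (1 - \<delta>) ^ k"
    using cI \<delta> by (intro mult_right_mono) auto
  ultimately have "card {i\<in>I. (\<lambda>(b, b'). sym_diff b b') i \<inter> Y = {}} = 0"
    using Y(4) by linarith
  then have empty: "{i\<in>I. (\<lambda>(b, b'). sym_diff b b') i \<inter> Y = {}} = {}"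
    using finI by simp
  have inj: "inj_on (\<lambda>b. b \<inter> Y) G"
    by (rule inj_onI) (use empty in \<open>auto simp: I_def\<close>)
  let ?F = "(\<lambda>b. b \<inter> Y) ` G"
  txt \<open>The points of \<open>Y\<close> distinguish the members of \<open>G\<close>, so the Sauer--Shelah bound applies to the traces.\<close>
  have "real m = real (card ?F)" using inj by (simp add: m_def card_image)
  also have "card ?F \<le> card {Z. Z \<subseteq> Y \<and> shatters ?F Z}"
    using Y by (intro card_le_card_shattered) auto
  also have "\<dots> \<le> card {Z. Z \<subseteq> Y \<and> card Z \<le> v}"
  proof (rule card_mono)
    show "{Z. Z \<subseteq> Y \<and> shatters ?F Z} \<subseteq> {Z. Z \<subseteq> Y \<and> card Z \<le> v}"
    proof (clarsimp)
      fix Z assume Z: "Z \<subseteq> Y" "shatters ?F Z"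
      have "shatters B Z" unfolding shatters_def
      proof (intro allI impI)
        fix W assume "W \<subseteq> Z"
        then obtain b where "b \<in> G" "b \<inter> Y \<inter> Z = W" using Z(2) by (auto simp: shatters_def)
        then show "\<exists>b\<in>B. b \<inter> Z = W" using Z(1) G by (intro bexI[of _ b]) auto
      qed
      moreover have "Z \<subseteq> space M" "finite Z" using Z Y by (auto intro: finite_subset)
      ultimately show "card Z \<le> v" using vc by (auto simp: vc_dim_def)
    qed
  qed (use Y in simp)
  also have "\<dots> \<le> (\<Sum>i\<le>v. k choose i)" by (rule card_subsets_le[OF Y(2,3)])
  also have "real \<dots> \<le> (exp 1 * real k / real v) ^ v" by (rule sum_binomial_le[OF v vk])
  also have "exp 1 * real k / real v = exp 1 * real q" using v by (simp add: k_def)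
  finally have "u ^ v \<le> (exp 1 * real q) ^ v" by (simp add: um)
  then have "u \<le> exp 1 * real q" using v by (subst (asm) power_mono_iff) (auto simp: u_def)
  also have "\<dots> \<le> exp 1 * (2 * l / \<delta> + 1)" using q by simp
  finally have u: "u \<le> exp 1 * (2 * l / \<delta> + 1)" .
  txt \<open>Bounding \<open>ln u\<close> through \<open>sqrt u\<close> solves this implicit inequality for \<open>u\<close>.\<close>
  define s where "s = exp (l / 2)"
  have us: "u = s * s" by (simp add: s_def u_def flip: exp_add)
  have s1: "1 + l / 2 \<le> s" unfolding s_def by (rule exp_ge_add_one_self)
  have "l \<le> 2 * (s - 1)" using s1 by (simp add: field_simps)
  then have "2 * l / \<delta> + 1 \<le> 2 * (2 * (s - 1)) / \<delta> + 1" using \<delta>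
    by (intro add_right_mono divide_right_mono) auto
  also have "\<dots> \<le> 4 * s / \<delta>" using \<delta> by (simp add: field_simps)
  finally have "s * s \<le> exp 1 * (4 * s / \<delta>)"
    using u us by (meson exp_ge_zero mult_left_mono order_trans)
  \<comment> \<open>Rounding \<open>exp 1\<close> up to 3 produces the constant 12.\<close>
  also have "\<dots> \<le> 3 * (4 * s / \<delta>)" using exp_le \<delta>
    by (intro mult_right_mono) (auto simp: s_def)
  finally have "s * s \<le> (12 / \<delta>) * s" by (simp add: field_simps)
  then have s: "s \<le> 12 / \<delta>" by (rule mult_right_le_imp_le) (simp add: s_def)
  have "real m = s ^ (2 * v)" using um us by (simp add: power_mult power2_eq_square)
  also have "\<dots> \<le> (12 / \<delta>) ^ (2 * v)" using s by (intro power_mono) (auto simp: s_def)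
  finally show ?thesis by (simp add: m_def)
qed

text \<open>The packing bound limits the size of separated subfamilies, so one of greatest
  cardinality exists. It covers \<open>B\<close>, as a member far from all of it could be
  added.\<close>

lemma exists_small_cover:
  assumes B: "B \<subseteq> sets M" and vc: "vc_dim (space M) B v" and v: "v \<ge> 1"
    and \<delta>: "0 < \<delta>" "\<delta> \<le> 1"
  shows "\<exists>G\<subseteq>B. finite G \<and> real (card G) \<le> (12 / \<delta>) ^ (2 * v) \<and>
           (\<forall>b\<in>B. \<exists>g\<in>G. prob (sym_diff b g) \<le> \<delta>)"
proof -
  define sep where "sep G \<longleftrightarrow> finite G \<and> G \<subseteq> B \<and>
    (\<forall>b\<in>G. \<forall>b'\<in>G. b \<noteq> b' \<longrightarrow> \<delta> < prob (sym_diff b b'))" for G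
  have bound: "real (card G) \<le> (12 / \<delta>) ^ (2 * v)" if "sep G" for G
    using that unfolding sep_def by (intro card_separated_le[OF B vc v \<delta>]) auto
  then have bnd: "\<forall>G. sep G \<longrightarrow> card G < nat \<lfloor>(12 / \<delta>) ^ (2 * v)\<rfloor> + 1"
    by (metis Suc_eq_plus1 le_nat_floor less_Suc_eq_le)
  have "sep {}" by (simp add: sep_def)
  then obtain G where G: "sep G" "\<And>H. sep H \<Longrightarrow> card H \<le> card G"
    using ex_has_greatest_nat[of sep "{}" card, OF _ bnd] by blast
  have "\<exists>g\<in>G. prob (sym_diff b g) \<le> \<delta>" if b: "b \<in> B" for b
  proof (rule ccontr)
    assume neg: "\<not> ?thesis"
    then have "b \<notin> G" using \<delta> by force
    have "sep (insert b G)" using G(1) b neg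
      by (auto simp: sep_def not_le Un_commute)
    then show False using G(2)[of "insert b G"] G(1) \<open>b \<notin> G\<close> by (simp add: sep_def)
  qed
  then show ?thesis using G bound by (auto simp: sep_def)
qed

section \<open>The common point of the large members\<close>

text \<open>Otherwise compactness and the Helly bound yield at most \<open>h\<close> of these sets
  with empty intersection. Their complements, each of probability below \<open>1 / h\<close>, would
  cover the whole space.\<close>

lemma helly_common_point:
  assumes B: "B \<subseteq> sets M" and cpt: "compact_family B" and hb: "helly_bound B h" and h: "h \<ge> 1"
  shows "\<exists>p\<in>space M. \<forall>b\<in>B. 1 - 1 / real h < prob b \<longrightarrow> p \<in> b"
proof -
  let ?L = "{b\<in>B. 1 - 1 / real h < prob b}"
  have "\<Inter>?L \<noteq> {}"
  proof
    assume "\<Inter>?L = {}"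
    then obtain L1 where L1: "L1 \<subseteq> ?L" "finite L1" "\<Inter>L1 = {}"
      using cpt unfolding compact_family_def by (metis (no_types, lifting) mem_Collect_eq subsetI)
    then obtain L where L: "L \<subseteq> L1" "card L \<le> h" "\<Inter>L = {}"
      using hb unfolding helly_bound_def by (metis (no_types, lifting) mem_Collect_eq subset_iff)
    have finL: "finite L" and ne: "L \<noteq> {}" using L L1 by (auto intro: finite_subset)
    have LM: "b \<in> sets M" "1 - 1 / real h < prob b" if "b \<in> L" for b
      using that L L1 B by auto
    have "space M = (\<Union>b\<in>L. space M - b)" using L(3) by auto
    then have "1 = prob (\<Union>b\<in>L. space M - b)" using prob_space by metis
    also have "\<dots> \<le> (\<Sum>b\<in>L. prob (space M - b))"
      using LM finL by (intro finite_measure_subadditive_finite) auto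
    also have "\<dots> < (\<Sum>b\<in>L. 1 / real h)"
      using finL ne LM(2) by (intro sum_strict_mono) (auto simp: prob_compl LM(1) algebra_simps)
    also have "\<dots> \<le> 1" using L(2) h by (simp add: field_simps)
    finally show False by simp
  qed
  then obtain p where p: "\<forall>b\<in>?L. p \<in> b" by auto
  obtain x where x: "x \<in> space M" using not_empty by auto
  show ?thesis
  \<comment> \<open>The empty intersection is \<open>UNIV\<close>, so \<open>p\<close> may lie
    outside \<open>space M\<close> when no set is large; any point of the space then serves.\<close>
  proof (cases "?L = {}")
    case True
    then show ?thesis using x by auto
  next
    case False
    then obtain b where "b \<in> B" "p \<in> b" using p by auto
    then have "p \<in> space M" using B sets.sets_into_space by blast
    then show ?thesis using p by auto
  qed
qed

end

section \<open>Numerical estimates for one round of conditioning\<close>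

text \<open>The right side is the mass of \<open>c\<close> that must survive inside
  \<open>g\<close>, and the last factor on the left bounds the mass of \<open>g\<close>. Their
  quotient is therefore at least the new threshold
  \<open>\<epsilon> * exp (3 / (4 * h))\<close>.\<close>

lemma shrink_gain:
  fixes h \<epsilon> :: real
  assumes "1 \<le> h" "0 < \<epsilon>" "\<epsilon> \<le> 1 - 1 / h"
  shows "\<epsilon> * exp (3 / (4 * h)) * (1 - 1 / h + \<epsilon> / (20 * h)) \<le> \<epsilon> - \<epsilon> / (20 * h)"
proof -
  \<comment> \<open>In this unit \<open>1 / h\<close> is \<open>5 * y\<close>,
    \<open>3 / (4 * h)\<close> is \<open>15 * y / 4\<close> and \<open>1 / (20 * h)\<close> is
    \<open>y / 4\<close>, so the exponents below add up to \<open>- y\<close>.\<close>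
  define y where "y = 1 / (5 * h)"
  have y: "0 < y" "y \<le> 1" using assms by (auto simp: y_def field_simps)
  have "1 - 1 / h + \<epsilon> / (20 * h) \<le> 1 - 1 / h + (1 - 1 / h) / (20 * h)"
    using assms by (intro add_left_mono divide_right_mono) auto
  also have "\<dots> = (1 - 5 * y) * (1 + y / 4)" using assms by (simp add: y_def field_simps)
  also have "\<dots> \<le> exp (- (5 * y)) * exp (y / 4)"
    using y assms exp_ge_add_one_self[of "- (5 * y)"] exp_ge_add_one_self[of "y / 4"]
    by (intro mult_mono) auto
  finally have "exp (3 / (4 * h)) * (1 - 1 / h + \<epsilon> / (20 * h)) \<le>
      exp (3 / (4 * h)) * (exp (- (5 * y)) * exp (y / 4))" by simp
  also have "\<dots> = exp (- y)"
    by (simp add: y_def add_divide_distrib[symmetric] field_simps flip: exp_add)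
  also have "\<dots> \<le> 1 / (1 + y)"
    using y exp_ge_add_one_self[of y] by (simp add: exp_minus field_simps)
  also have "\<dots> \<le> 1 - y / 4"
  proof -
    have "y * y \<le> y * 1" using y by (intro mult_left_mono) auto
    then show ?thesis using y by (simp add: field_simps)
  qed
  finally have "\<epsilon> * (exp (3 / (4 * h)) * (1 - 1 / h + \<epsilon> / (20 * h))) \<le> \<epsilon> * (1 - y / 4)"
    using assms by (intro mult_left_mono) auto
  then show ?thesis by (simp add: y_def algebra_simps)
qed

text \<open>One round multiplies the size by at most \<open>P powr (2 * v)\<close>, the size of the
  cover. Lowering \<open>ln (1 / \<epsilon>)\<close> by \<open>3 / (4 * h)\<close> lowers the
  exponent by \<open>3 * v\<close>. The spare factor \<open>P powr v\<close> absorbs the one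
  additional point.\<close>

lemma net_size_recursion:
  fixes h \<epsilon> :: real and v :: nat
  assumes h: "2 \<le> h" and v: "1 \<le> v" and \<epsilon>: "0 < \<epsilon>" "\<epsilon> \<le> 1 - 1 / h"
    and \<epsilon>': "\<epsilon>' = \<epsilon> * exp (3 / (4 * h))"
  shows "1 + (12 / (\<epsilon> / (20 * h))) ^ (2 * v) *
           (120 * h ^ 2 / \<epsilon>') powr (4 * h * real v * ln (1 / \<epsilon>')) <
         (120 * h ^ 2 / \<epsilon>) powr (4 * h * real v * ln (1 / \<epsilon>))"
    and "\<epsilon>' < 1" and "ln (1 / \<epsilon>') = ln (1 / \<epsilon>) - 3 / (4 * h)"
proof -
  define P where "P = 120 * h ^ 2 / \<epsilon>"
  define L where "L = ln (1 / \<epsilon>)"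
  define Q where "Q = P powr (4 * h * real v * L)"
  have L': "ln (1 / \<epsilon>') = L - 3 / (4 * h)"
    using \<epsilon> by (simp add: \<epsilon>' L_def ln_div ln_mult)
  then show "ln (1 / \<epsilon>') = ln (1 / \<epsilon>) - 3 / (4 * h)" by (simp add: L_def)
  \<comment> \<open>From \<open>ln \<epsilon> \<le> \<epsilon> - 1\<close>. As
    \<open>3 / (4 * h)\<close> is less than \<open>1 / h\<close>, the new threshold stays below
    1.\<close>
  have "1 / h \<le> L" using \<epsilon> ln_le_minus_one[of \<epsilon>] by (simp add: L_def ln_div)
  then have hL: "1 \<le> h * L" using h by (simp add: field_simps)
  have "3 / (4 * h) < 1 / h" using h by (simp add: field_simps)
  then have L'pos: "0 < ln (1 / \<epsilon>')" using L' \<open>1 / h \<le> L\<close> by linarith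
  have \<epsilon>'0: "0 < \<epsilon>'" "\<epsilon> \<le> \<epsilon>'" using \<epsilon> h by (auto simp: \<epsilon>')
  then show "\<epsilon>' < 1" using L'pos by (simp add: ln_div)
  have "2 * 2 \<le> h * h" using h by (intro mult_mono) auto
  moreover have "\<epsilon> \<le> 1" using \<epsilon> h by (smt (verit) divide_nonneg_nonneg)
  ultimately have P: "480 \<le> P" using \<epsilon> by (simp add: P_def field_simps power2_eq_square)
  have Pv: "P \<le> P powr real v" using powr_mono[of 1 "real v" P] P v by simp
  \<comment> \<open>The left side is \<open>240 * h / \<epsilon>\<close>; since \<open>h\<close> is
    at least 2, the base \<open>120 * h ^ 2 / \<epsilon>\<close> dominates it.\<close>
  have "12 / (\<epsilon> / (20 * h)) \<le> P"
  proof -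
    have "2 * h \<le> h * h" using h by (intro mult_right_mono) auto
    then show ?thesis using \<epsilon> h by (simp add: P_def power2_eq_square divide_right_mono)
  qed
  then have "(12 / (\<epsilon> / (20 * h))) ^ (2 * v) \<le> P ^ (2 * v)"
    using \<epsilon> h by (intro power_mono) auto
  also have "\<dots> = P powr (2 * real v)" using P by (simp flip: powr_realpow)
  finally have m: "(12 / (\<epsilon> / (20 * h))) ^ (2 * v) \<le> P powr (2 * real v)" .
  have "(120 * h ^ 2 / \<epsilon>') powr (4 * h * real v * ln (1 / \<epsilon>')) \<le> P powr (4 * h * real v * ln (1 / \<epsilon>'))"
    using \<epsilon>'0 \<epsilon> h L'pos unfolding P_def
    by (intro powr_mono2 divide_left_mono) auto
  also have "\<dots> = P powr (4 * h * real v * L - 3 * real v)"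
  proof -
    have "4 * h * real v * ln (1 / \<epsilon>') = 4 * h * real v * L - 3 * real v"
      using h unfolding L' by (simp add: right_diff_distrib)
    then show ?thesis by simp
  qed
  finally have Q': "(120 * h ^ 2 / \<epsilon>') powr (4 * h * real v * ln (1 / \<epsilon>'))
      \<le> P powr (4 * h * real v * L - 3 * real v)" .
  have "(12 / (\<epsilon> / (20 * h))) ^ (2 * v) *
      (120 * h ^ 2 / \<epsilon>') powr (4 * h * real v * ln (1 / \<epsilon>'))
      \<le> P powr (2 * real v) * P powr (4 * h * real v * L - 3 * real v)"
    by (rule mult_mono[OF m Q']) auto
  also have "\<dots> = Q / P powr real v"
    by (simp add: Q_def flip: powr_add powr_diff)
  also have "\<dots> \<le> Q / 480" using P Pv by (intro divide_left_mono) (auto simp: Q_def)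
  \<comment> \<open>It suffices that \<open>Q\<close> is at least 480, which follows from
    \<open>P powr v \<le> Q\<close>, an inequality of exponents based on
    \<open>1 \<le> h * L\<close>.\<close>
  also have "\<dots> < Q - 1"
  proof -
    have "real v \<le> real v * (h * L)" using hL v by simp
    then have "real v \<le> 4 * h * real v * L" using v hL by (simp add: algebra_simps)
    then have "P powr real v \<le> Q" unfolding Q_def using P by (intro powr_mono) auto
    then show ?thesis using Pv P by simp
  qed
  finally show "1 + (12 / (\<epsilon> / (20 * h))) ^ (2 * v) *
           (120 * h ^ 2 / \<epsilon>') powr (4 * h * real v * ln (1 / \<epsilon>')) <
         (120 * h ^ 2 / \<epsilon>) powr (4 * h * real v * ln (1 / \<epsilon>))"
    by (simp add: Q_def P_def L_def)
qed

section \<open>Construction of the net by repeated conditioning\<close>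

text \<open>Here \<open>n\<close> bounds the number of rounds. The measure and the threshold vary in
  the induction, since the hypothesis is applied to conditioned measures at a larger threshold;
  conditioning changes neither the space nor the measurable sets. The case \<open>n = 0\<close> is
  vacuous because \<epsilon> is below 1.\<close>

lemma weak_eps_net_by_scales:
  fixes B :: "'a set set" and v h :: nat
  assumes cpt: "compact_family B" and hb: "helly_bound B h" and h: "h \<ge> 1" and v: "v \<ge> 1"
  shows "prob_space M \<Longrightarrow> intersection_closure B \<subseteq> sets M \<Longrightarrow> vc_dim (space M) B v \<Longrightarrow>
    0 < \<epsilon> \<Longrightarrow> \<epsilon> < 1 \<Longrightarrow> ln (1 / \<epsilon>) \<le> real n * (3 / (4 * real h)) \<Longrightarrow>
    \<exists>S\<subseteq>space M. finite S \<and>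
      real (card S) < (120 * real h ^ 2 / \<epsilon>) powr (4 * real h * real v * ln (1 / \<epsilon>)) \<and>
      weak_eps_net M (intersection_closure B) \<epsilon> S"
proof (induction n arbitrary: M \<epsilon>)
  case 0
  then show ?case by (simp add: ln_div)
next
  case (Suc n)
  interpret prob_space M by fact
  note \<epsilon> = Suc.prems(4,5)
  have "{b} \<subseteq> B \<Longrightarrow> \<Inter>{b} \<in> intersection_closure B" for b
    unfolding intersection_closure_def by blast
  then have BM: "B \<subseteq> sets M" using Suc.prems(2) by auto
  obtain p where p: "p \<in> space M" "\<And>b. b \<in> B \<Longrightarrow> 1 - 1 / real h < prob b \<Longrightarrow> p \<in> b"
    using helly_common_point[OF BM cpt hb h] by blast
  show ?case
  \<comment> \<open>Above this threshold every member of \<open>B\<close> containing a heavy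
    \<open>c\<close> is itself large, so \<open>p\<close> alone is a net.\<close>
  proof (cases "1 - 1 / real h < \<epsilon>")
    case True
    have "p \<in> c" if c: "c \<in> intersection_closure B" "\<epsilon> \<le> prob c" for c
    proof -
      obtain F where F: "F \<subseteq> B" "c = \<Inter>F" using c by (auto simp: intersection_closure_def)
      have "p \<in> b" if b: "b \<in> F" for b
      proof (rule p(2))
        show "b \<in> B" using b F by auto
        have "prob c \<le> prob b" using b F BM by (intro finite_measure_mono) auto
        then show "1 - 1 / real h < prob b" using True c by simp
      qed
      then show ?thesis using F by auto
    qed
    moreover have "1 < (120 * real h ^ 2 / \<epsilon>) powr (4 * real h * real v * ln (1 / \<epsilon>))"
    proof (rule gr_one_powr)
      have "1 \<le> real h ^ 2" using h by (intro one_le_power) simp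
      then show "1 < 120 * real h ^ 2 / \<epsilon>" using \<epsilon> by (simp add: field_simps)
      show "0 < 4 * real h * real v * ln (1 / \<epsilon>)" using \<epsilon> h v by simp
    qed
    ultimately show ?thesis using p(1)
      by (intro exI[of _ "{p}"]) (auto simp: weak_eps_net_def)
  next
    case False
    \<comment> \<open>For \<open>h = 1\<close> the threshold \<open>1 - 1 / h\<close> is 0, and the
      previous case would apply.\<close>
    have h2: "2 \<le> real h"
    proof -
      have "h \<noteq> 1" using False \<epsilon> by auto
      then show ?thesis using h by simp
    qed
    define \<delta> where "\<delta> = \<epsilon> / (20 * real h)"
    define \<epsilon>' where "\<epsilon>' = \<epsilon> * exp (3 / (4 * real h))"
    note rec = net_size_recursion[OF h2 v \<epsilon>(1) _ \<epsilon>'_def]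
    have "\<epsilon> < 20 * real h" using \<epsilon> h2 by linarith
    then have \<delta>: "0 < \<delta>" "\<delta> \<le> 1" "\<delta> < \<epsilon>" using \<epsilon> h2 by (auto simp: \<delta>_def field_simps)
    obtain G where G: "G \<subseteq> B" "finite G" "real (card G) \<le> (12 / \<delta>) ^ (2 * v)"
      "\<And>b. b \<in> B \<Longrightarrow> \<exists>g\<in>G. prob (sym_diff b g) \<le> \<delta>"
      using exists_small_cover[OF BM Suc.prems(3) v \<delta>(1,2)] by blast
    define Q where "Q = (120 * real h ^ 2 / \<epsilon>') powr (4 * real h * real v * ln (1 / \<epsilon>'))"
    \<comment> \<open>Conditioning requires positive probability. No needed \<open>g\<close> is
      lost: one close to a set containing a heavy \<open>c\<close> has probability at least
      \<open>\<epsilon> - \<delta>\<close>.\<close>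
    define H where "H = {g\<in>G. 0 < prob g}"
    have "\<exists>S\<subseteq>space M. finite S \<and> real (card S) < Q \<and>
        weak_eps_net (uniform_measure M g) (intersection_closure B) \<epsilon>' S" if g: "g \<in> H" for g
    proof -
      have g': "g \<in> sets M" "0 < prob g" using g G BM by (auto simp: H_def)
      have "prob_space (uniform_measure M g)"
        using g' by (intro prob_space_uniform_measure) (auto simp: emeasure_eq_measure)
      moreover have "ln (1 / \<epsilon>') \<le> real n * (3 / (4 * real h))"
        using rec(3) False Suc.prems(6) by (simp add: algebra_simps add_divide_distrib)
      moreover have "0 < \<epsilon>'" "\<epsilon>' < 1" using rec(2) False \<epsilon> by (auto simp: \<epsilon>'_def)
      ultimately show ?thesis
        using Suc.IH[of "uniform_measure M g" \<epsilon>'] Suc.prems(2,3) by (simp add: Q_def)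
    qed
    then obtain T where T: "\<And>g. g \<in> H \<Longrightarrow> T g \<subseteq> space M \<and> finite (T g) \<and> real (card (T g)) < Q \<and>
        weak_eps_net (uniform_measure M g) (intersection_closure B) \<epsilon>' (T g)" by metis
    define S where "S = insert p (\<Union>g\<in>H. T g)"
    have finH: "finite H" and cH: "card H \<le> card G"
      using G by (auto simp: H_def intro: card_mono)
    have "card S \<le> 1 + (\<Sum>g\<in>H. card (T g))"
    proof -
      have "card S \<le> Suc (card (\<Union>g\<in>H. T g))"
        unfolding S_def using finH T by (subst card_insert_if) auto
      then show ?thesis using card_UN_le[OF finH, of T] by linarith
    qed
    then have "real (card S) \<le> 1 + (\<Sum>g\<in>H. real (card (T g)))"
      by (metis of_nat_1 of_nat_add of_nat_le_iff of_nat_sum)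
    also have "\<dots> \<le> 1 + (\<Sum>g\<in>H. Q)" using T by (intro add_left_mono sum_mono) (auto intro: less_imp_le)
    also have "\<dots> \<le> 1 + (12 / \<delta>) ^ (2 * v) * Q"
      using G(3) cH by (auto simp: Q_def intro!: mult_right_mono)
    also have "\<dots> < (120 * real h ^ 2 / \<epsilon>) powr (4 * real h * real v * ln (1 / \<epsilon>))"
      using rec(1) False by (simp add: Q_def \<delta>_def)
    finally have cS: "real (card S) < (120 * real h ^ 2 / \<epsilon>) powr (4 * real h * real v * ln (1 / \<epsilon>))" .
    have "S \<inter> c \<noteq> {}" if c: "c \<in> intersection_closure B" "\<epsilon> \<le> prob c" for c
    proof -
      obtain F where F: "F \<subseteq> B" "c = \<Inter>F" using c by (auto simp: intersection_closure_def)
      have cM: "c \<in> sets M" using c Suc.prems(2) by auto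
      show ?thesis
      proof (cases "\<forall>b\<in>F. 1 - 1 / real h < prob b")
        case True
        then have "p \<in> c" using F p(2) by auto
        then show ?thesis by (auto simp: S_def)
      next
        case False
        then obtain b where b: "b \<in> F" "prob b \<le> 1 - 1 / real h" by (auto simp: not_less)
        then obtain g where g: "g \<in> G" "prob (sym_diff b g) \<le> \<delta>" using G(4) F by blast
        have M: "b \<in> sets M" "g \<in> sets M" using b g F G BM by auto
        \<comment> \<open>Since \<open>c\<close> is contained in \<open>b\<close>, its points
          outside \<open>g\<close> lie in the symmetric difference of \<open>b\<close> and
          \<open>g\<close>.\<close>
        have "prob c \<le> prob ((g \<inter> c) \<union> sym_diff b g)"
          using b F M cM by (intro finite_measure_mono) auto
        also have "\<dots> \<le> prob (g \<inter> c) + prob (sym_diff b g)"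
          using M cM by (intro measure_Un_le) auto
        finally have gc: "\<epsilon> - \<delta> \<le> prob (g \<inter> c)" using c g by linarith
        have "prob g \<le> prob (b \<union> sym_diff b g)" using M by (intro finite_measure_mono) auto
        also have "\<dots> \<le> prob b + prob (sym_diff b g)" using M by (intro measure_Un_le) auto
        finally have pg: "prob g \<le> 1 - 1 / real h + \<delta>" using b g by linarith
        have "prob (g \<inter> c) \<le> prob g" using M by (intro finite_measure_mono) auto
        then have g0: "0 < prob g" using gc \<delta> by linarith
        then have gH: "g \<in> H" using g by (simp add: H_def)
        have "\<epsilon>' * prob g \<le> \<epsilon>' * (1 - 1 / real h + \<delta>)"
          using pg \<epsilon> by (intro mult_left_mono) (auto simp: \<epsilon>'_def)
        also have "\<dots> \<le> \<epsilon> - \<delta>"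
          using shrink_gain[of "real h" \<epsilon>] h \<epsilon> \<open>\<not> 1 - 1 / real h < \<epsilon>\<close>
          by (simp add: \<epsilon>'_def \<delta>_def)
        finally have "\<epsilon>' \<le> prob (g \<inter> c) / prob g" using gc g0 by (simp add: pos_le_divide_eq)
        also have "\<dots> = measure (uniform_measure M g) c"
          using M cM g0 by (subst measure_uniform_measure) (auto simp: emeasure_eq_measure)
        finally have "T g \<inter> c \<noteq> {}" using T[OF gH] c by (auto simp: weak_eps_net_def)
        then show ?thesis using gH by (auto simp: S_def)
      qed
    qed
    then show ?thesis using cS p(1) T finH
      by (intro exI[of _ S]) (auto simp: S_def weak_eps_net_def)
  qed
qed

theorem theorem3:
  fixes X :: "'a set" and B :: "'a set set" and v h :: nat
    and \<epsilon> :: real and M :: "'a measure"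
  assumes "B \<subseteq> Pow X"
    and "compact_family B"
    and "vc_dim X B v" and "v \<ge> 1"
    and "helly_number B h" and "h \<ge> 1"
    and "0 < \<epsilon>" and "\<epsilon> < 1"
    and "prob_space M" and "space M = X"
    and "intersection_closure B \<subseteq> sets M"
  shows "\<exists>S\<subseteq>X. finite S \<and>
           real (card S) < (120 * real h ^ 2 / \<epsilon>) powr (4 * real h * real v * ln (1 / \<epsilon>)) \<and>
           weak_eps_net M (intersection_closure B) \<epsilon> S"
proof -
  \<comment> \<open>Any sufficiently large number of rounds will do, because the size bound does not
    depend on \<open>n\<close>.\<close>
  obtain n :: nat where "ln (1 / \<epsilon>) / (3 / (4 * real h)) \<le> real n"
    using real_arch_simple by blast
  then have "ln (1 / \<epsilon>) \<le> real n * (3 / (4 * real h))"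
    using \<open>h \<ge> 1\<close> by (simp add: field_simps)
  then show ?thesis
    using weak_eps_net_by_scales[of B h v M \<epsilon> n] assms by (auto simp: helly_number_def)
qed

end
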